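(* Let $\bar{x}\in\mathcal{F}$ be a locally optimal solution of (MPSC). Assume that $\bar{x}$ is an $S$-stationary point of (MPSC) and that the MPSC-tailored weak second-order constraint qualification (MPSC-WSOCQ) holds at $\bar{x}$. Then the MPSC-tailored weak second-order necessary condition (MPSC-WSONC) holds at $\bar{x}$, i.e. for every multiplier $(\lambda,\rho,\mu,\nu)\in\mathbb{R}^m_+\times\mathbb{R}^p\times\mathbb{R}^l\times\mathbb{R}^l$ satisfying the $S$-stationarity system at $\bar{x}$, $$\tilde d^\top\nabla^2_{xx}\ell(\bar{x},\lambda,\rho,\mu,\nu)\tilde d\ge 0\quad\text{for all } \tilde d\in\tilde{\mathcal{C}}^{MPSC}_{\mathcal{F}}(\bar{x}).$$
   Context: (MPSC) is the problem: minimize $f(x)$ over $x\in\mathbb{R}^n$ subject to $g_i(x)\le 0$ ($i=1,\dots,m$), $h_j(x)=0$ ($j=1,\dots,p$), $G_k(x)H_k(x)=0$ ($k=1,\dots,l$), where $f,g_i,h_j,G_k,H_k:\mathbb{R}^n\to\mathbb{R}$ are twice continuously differentiable. $\mathcal{F}$ denotes its feasible set. For a feasible point $\bar{x}$: $\mathcal{I}_h=\{1,\dots,p\}$, $\mathcal{I}_g=\{i: g_i(\bar{x})=0\}$, $\mathcal{I}_G=\{k: G_k(\bar{x})=0,\,H_k(\bar{x})\neq0\}$, $\mathcal{I}_H=\{k: G_k(\bar{x})\ne0,\,H_k(\bar{x})=0\}$, $\mathcal{I}_{GH}=\{k: G_k(\bar{x})=H_k(\bar{x})=0\}$. Lagrangian: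 $\ell(x,\lambda,\rho,\mu,\nu)=f(x)+\lambda^\top g(x)+\rho^\top h(x)+\mu^\top G(x)+\nu^\top H(x)$. $\bar{x}\in\mathcal{F}$ is $S$-stationary if there is $(\lambda,\rho,\mu,\nu)\in\mathbb{R}^m_+\times\mathbb{R}^p\times\mathbb{R}^l\times\mathbb{R}^l$ satisfying the $S$-stationarity system: $\nabla_x\ell(\bar{x},\lambda,\rho,\mu,\nu)=0$, $\lambda^\top g(\bar{x})=0$, $\mu_k=0$ for $k\in\mathcal{I}_H$, $\nu_k=0$ for $k\in\mathcal{I}_G$, $\mu_k=\nu_k=0$ for $k\in\mathcal{I}_{GH}$. Critical subspace: $\tilde{\mathcal{C}}^{MPSC}_{\mathcal{F}}(\bar{x})$ is the set of $d\in\mathbb{R}^n$ with $\nabla g_i(\bar{x})^\top d=0$ ($i\in\mathcal{I}_g$), $\nabla h_j(\bar{x})^\top d=0$ ($j\in\mathcal{I}_h$), $\nabla G_k(\bar{x})^\top d=0$ ($k\in\mathcal{I}_G\cup\mathcal{I}_{GH}$), $\nabla H_k(\bar{x})^\top d=0$ ($k\in\mathcal{I}_H\cup\mathcal{I}_{GH}$). MPSC-WSOCQ holds at $\bar{x}$ if for every nonzero $\tilde d\in\tilde{\mathcal{C}}^{MPSC}_{\mathcal{F}}(\bar{x})$ there exist $\delta>0$, sets $\mathcal{J},\mathcal{K}\subseteq\mathcal{I}_{GH}$ and a twice differentiable arc $\zeta:[0,\delta)\to\mathbb{R}^n$ such that $\zeta(t)\in\mathcal{F}$ for all $t\in[0,\delta)$;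 $\zeta(0)=\bar{x}$ and $\zeta'_+(0)=\tilde d$ (right derivative); and for all $t\in[0,\delta)$: $g_i(\zeta(t))=0$ for $i\in\mathcal{I}_g$, $G_k(\zeta(t))=0$ for $k\in\mathcal{I}_G\cup\mathcal{J}$, $H_k(\zeta(t))=0$ for $k\in\mathcal{I}_H\cup\mathcal{K}$. *)

theory Defs
  imports "HOL-Analysis.Analysis"
begin

definition grad :: "(real^'n \<Rightarrow> real) \<Rightarrow> real^'n \<Rightarrow> real^'n" where
  "grad \<phi> x = (THE D. GDERIV \<phi> x :> D)"

definition hessian :: "(real^'n \<Rightarrow> real) \<Rightarrow> real^'n \<Rightarrow> real^'n^'n" where
  "hessian \<phi> x = matrix (frechet_derivative (grad \<phi>) (at x))"

definition twice_cont_diff :: "(real^'n \<Rightarrow> real) \<Rightarrow> bool" where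
  "twice_cont_diff \<phi> \<longleftrightarrow>
     (\<forall>x. \<phi> differentiable (at x)) \<and> (\<forall>x. grad \<phi> differentiable (at x)) \<and>
     continuous_on UNIV (hessian \<phi>)"

text \<open>Derivatives are taken within \<open>S\<close>, hence are one-sided at an endpoint of an
  interval that belongs to it.\<close>

definition twice_differentiable_arc_on :: "(real \<Rightarrow> real^'n) \<Rightarrow> real set \<Rightarrow> bool" where
  "twice_differentiable_arc_on \<zeta> S \<longleftrightarrow>
     (\<exists>\<zeta>'. (\<forall>t\<in>S. (\<zeta> has_vector_derivative \<zeta>' t) (at t within S)) \<and> \<zeta>' differentiable_on S)"

text \<open>Minimize \<open>f x\<close> subject to \<open>g\<^sub>i x \<le> 0\<close> for \<open>i = 1..m\<close>, \<open>h\<^sub>j x = 0\<close> for \<open>j = 1..p\<close>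
  and \<open>G\<^sub>k x * H\<^sub>k x = 0\<close> for \<open>k = 1..l\<close>.  Each of the three numbers of constraints may be zero,
  so constraints and multipliers are families over \<^typ>\<open>nat\<close> of which only the indices in
  these ranges are used.\<close>

record 'n mpsc =
  objective :: "real^'n \<Rightarrow> real"
  num_ineq :: nat
  ineq_con :: "nat \<Rightarrow> real^'n \<Rightarrow> real"
  num_eq :: nat
  eq_con :: "nat \<Rightarrow> real^'n \<Rightarrow> real"
  num_switch :: nat
  switchG :: "nat \<Rightarrow> real^'n \<Rightarrow> real"
  switchH :: "nat \<Rightarrow> real^'n \<Rightarrow> real"

definition mpsc_smooth :: "'n::finite mpsc \<Rightarrow> bool" where
  "mpsc_smooth P \<longleftrightarrow>
     twice_cont_diff (objective P) \<and>
     (\<forall>i\<in>{1..num_ineq P}. twice_cont_diff (ineq_con P i)) \<and>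
     (\<forall>j\<in>{1..num_eq P}. twice_cont_diff (eq_con P j)) \<and>
     (\<forall>k\<in>{1..num_switch P}. twice_cont_diff (switchG P k) \<and> twice_cont_diff (switchH P k))"

definition feasible_set :: "'n::finite mpsc \<Rightarrow> (real^'n) set" where
  "feasible_set P = {x.
     (\<forall>i\<in>{1..num_ineq P}. ineq_con P i x \<le> 0) \<and>
     (\<forall>j\<in>{1..num_eq P}. eq_con P j x = 0) \<and>
     (\<forall>k\<in>{1..num_switch P}. switchG P k x * switchH P k x = 0)}"

definition locally_optimal :: "'n::finite mpsc \<Rightarrow> real^'n \<Rightarrow> bool" where
  "locally_optimal P x \<longleftrightarrow> x \<in> feasible_set P \<and>
     (\<exists>\<epsilon>>0. \<forall>y \<in> feasible_set P \<inter> ball x \<epsilon>. objective P x \<le> objective P y)"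

definition I_h :: "'n::finite mpsc \<Rightarrow> nat set" where
  "I_h P = {1..num_eq P}"

definition I_g :: "'n::finite mpsc \<Rightarrow> real^'n \<Rightarrow> nat set" where
  "I_g P x = {i \<in> {1..num_ineq P}. ineq_con P i x = 0}"

definition I_G :: "'n::finite mpsc \<Rightarrow> real^'n \<Rightarrow> nat set" where
  "I_G P x = {k \<in> {1..num_switch P}. switchG P k x = 0 \<and> switchH P k x \<noteq> 0}"

definition I_H :: "'n::finite mpsc \<Rightarrow> real^'n \<Rightarrow> nat set" where
  "I_H P x = {k \<in> {1..num_switch P}. switchG P k x \<noteq> 0 \<and> switchH P k x = 0}"

definition I_GH :: "'n::finite mpsc \<Rightarrow> real^'n \<Rightarrow> nat set" where
  "I_GH P x = {k \<in> {1..num_switch P}. switchG P k x = 0 \<and> switchH P k x = 0}"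

definition lagrangian ::
  "'n::finite mpsc \<Rightarrow> real^'n \<Rightarrow> (nat \<Rightarrow> real) \<Rightarrow> (nat \<Rightarrow> real) \<Rightarrow> (nat \<Rightarrow> real) \<Rightarrow> (nat \<Rightarrow> real) \<Rightarrow> real"
  where
  "lagrangian P x lam \<rho> \<mu> \<nu> =
     objective P x + (\<Sum>i=1..num_ineq P. lam i * ineq_con P i x) + (\<Sum>j=1..num_eq P. \<rho> j * eq_con P j x)
     + (\<Sum>k=1..num_switch P. \<mu> k * switchG P k x) + (\<Sum>k=1..num_switch P. \<nu> k * switchH P k x)"

definition S_stationarity_system ::
  "'n::finite mpsc \<Rightarrow> real^'n \<Rightarrow> (nat \<Rightarrow> real) \<Rightarrow> (nat \<Rightarrow> real) \<Rightarrow> (nat \<Rightarrow> real) \<Rightarrow> (nat \<Rightarrow> real) \<Rightarrow> bool"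
  where
  "S_stationarity_system P x lam \<rho> \<mu> \<nu> \<longleftrightarrow>
     (\<forall>i\<in>{1..num_ineq P}. lam i \<ge> 0) \<and>
     grad (\<lambda>y. lagrangian P y lam \<rho> \<mu> \<nu>) x = 0 \<and>
     (\<Sum>i=1..num_ineq P. lam i * ineq_con P i x) = 0 \<and>
     (\<forall>k\<in>I_H P x. \<mu> k = 0) \<and>
     (\<forall>k\<in>I_G P x. \<nu> k = 0) \<and>
     (\<forall>k\<in>I_GH P x. \<mu> k = 0 \<and> \<nu> k = 0)"

definition S_stationary :: "'n::finite mpsc \<Rightarrow> real^'n \<Rightarrow> bool" where
  "S_stationary P x \<longleftrightarrow>
     x \<in> feasible_set P \<and> (\<exists>lam \<rho> \<mu> \<nu>. S_stationarity_system P x lam \<rho> \<mu> \<nu>)"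

definition critical_subspace :: "'n::finite mpsc \<Rightarrow> real^'n \<Rightarrow> (real^'n) set" where
  "critical_subspace P x = {d.
     (\<forall>i\<in>I_g P x. grad (ineq_con P i) x \<bullet> d = 0) \<and>
     (\<forall>j\<in>I_h P. grad (eq_con P j) x \<bullet> d = 0) \<and>
     (\<forall>k\<in>I_G P x \<union> I_GH P x. grad (switchG P k) x \<bullet> d = 0) \<and>
     (\<forall>k\<in>I_H P x \<union> I_GH P x. grad (switchH P k) x \<bullet> d = 0)}"

definition MPSC_WSOCQ :: "'n::finite mpsc \<Rightarrow> real^'n \<Rightarrow> bool" where
  "MPSC_WSOCQ P x \<longleftrightarrow>
     (\<forall>d \<in> critical_subspace P x. d \<noteq> 0 \<longrightarrow>
        (\<exists>\<delta>>0. \<exists>J K \<zeta>. J \<subseteq> I_GH P x \<and> K \<subseteq> I_GH P x \<and>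
           twice_differentiable_arc_on \<zeta> {0..<\<delta>} \<and>
           (\<forall>t\<in>{0..<\<delta>}. \<zeta> t \<in> feasible_set P) \<and>
           \<zeta> 0 = x \<and> (\<zeta> has_vector_derivative d) (at_right 0) \<and>
           (\<forall>t\<in>{0..<\<delta>}.
              (\<forall>i\<in>I_g P x. ineq_con P i (\<zeta> t) = 0) \<and>
              (\<forall>k\<in>I_G P x \<union> J. switchG P k (\<zeta> t) = 0) \<and>
              (\<forall>k\<in>I_H P x \<union> K. switchH P k (\<zeta> t) = 0))))"

definition MPSC_WSONC :: "'n::finite mpsc \<Rightarrow> real^'n \<Rightarrow> bool" where
  "MPSC_WSONC P x \<longleftrightarrow>
     (\<forall>lam \<rho> \<mu> \<nu>. S_stationarity_system P x lam \<rho> \<mu> \<nu> \<longrightarrow>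
        (\<forall>d \<in> critical_subspace P x. d \<bullet> (hessian (\<lambda>y. lagrangian P y lam \<rho> \<mu> \<nu>) x *v d) \<ge> 0))"

end

theory Submission
  imports Defs
begin

text \<open>
  Restrict the Lagrangian to an arc \<open>\<zeta>\<close> supplied by the constraint qualification.  By
  complementarity and S-stationarity, a constraint with nonzero multiplier is active along
  the whole arc: an inactive inequality has multiplier zero, and at a biactive switching
  pair, where the arc may leave along either branch, both multipliers are zero.  So the
  Lagrangian coincides with the objective on the arc (\<open>lagrangian_eq_objective\<close>), and
  local optimality makes \<open>u t = \<ell> (\<zeta> t)\<close> minimal at \<open>t = 0\<close> over small \<open>t \<ge> 0\<close>.

  The one-sided derivatives of \<open>u\<close> at \<open>0\<close> are \<open>u' 0 = \<nabla>\<ell>(x) \<bullet> d = 0\<close> and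
  \<open>u'' 0 = d \<bullet> (\<nabla>\<^sup>2\<ell>(x) d) + \<nabla>\<ell>(x) \<bullet> \<zeta>''(0)\<close>.  Stationarity removes the curvature of the arc from
  the second, and what is left, the quadratic form of the Lagrangian at \<open>d\<close>, must be
  nonnegative (\<open>hessian_nonneg_along_arc\<close>).
\<close>

definition twice_diff :: "(real^'n \<Rightarrow> real) \<Rightarrow> bool" where
  "twice_diff \<phi> \<longleftrightarrow> (\<forall>x. \<phi> differentiable (at x)) \<and> (\<forall>x. grad \<phi> differentiable (at x))"

lemma twice_cont_diff_imp_twice_diff: "twice_cont_diff \<phi> \<Longrightarrow> twice_diff \<phi>"
  by (simp add: twice_cont_diff_def twice_diff_def)

lemma GDERIV_unique:
  assumes "GDERIV \<phi> x :> D" "GDERIV \<phi> x :> E"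
  shows "D = E"
proof -
  have "(\<lambda>h. h \<bullet> D) = (\<lambda>h. h \<bullet> E)"
    using assms unfolding gderiv_def by (rule has_derivative_unique)
  then show ?thesis
    by (metis vector_eq_ldot)
qed

lemma grad_eqI: "GDERIV \<phi> x :> D \<Longrightarrow> grad \<phi> x = D"
  unfolding grad_def
  by (rule the_equality) (auto intro: GDERIV_unique)

text \<open>In a Euclidean space the derivative is represented by a vector, its adjoint at \<open>1\<close>;
  hence the description operator in the definition of the gradient denotes.\<close>

lemma GDERIV_grad:
  assumes "\<phi> differentiable (at x)"
  shows "GDERIV \<phi> x :> grad \<phi> x"
proof -
  obtain D where D: "(\<phi> has_derivative D) (at x)"
    using assms by (auto simp: differentiable_def)
  then have "linear D"
    by (rule has_derivative_linear)
  then have "D = (\<lambda>h. h \<bullet> adjoint D 1)"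
    by (auto simp: adjoint_works)
  with D have "GDERIV \<phi> x :> adjoint D 1"
    unfolding gderiv_def by metis
  then show ?thesis
    by (simp add: grad_eqI)
qed

lemma twice_diff_add:
  assumes "twice_diff \<phi>" "twice_diff \<psi>"
  shows "twice_diff (\<lambda>x. \<phi> x + \<psi> x)"
proof -
  have "grad (\<lambda>x. \<phi> x + \<psi> x) = (\<lambda>x. grad \<phi> x + grad \<psi> x)"
    using assms by (intro ext grad_eqI GDERIV_add GDERIV_grad) (auto simp: twice_diff_def)
  then show ?thesis
    using assms by (simp add: twice_diff_def)
qed

lemma twice_diff_cmult:
  assumes "twice_diff \<phi>"
  shows "twice_diff (\<lambda>x. c * \<phi> x)"
proof -
  have "GDERIV (\<lambda>x. c * \<phi> x) x :> c *\<^sub>R grad \<phi> x" for x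
    using GDERIV_mult[OF GDERIV_const GDERIV_grad, of \<phi> x c] assms
    by (simp add: twice_diff_def)
  then have "grad (\<lambda>x. c * \<phi> x) = (\<lambda>x. c *\<^sub>R grad \<phi> x)"
    by (intro ext grad_eqI)
  then show ?thesis
    using assms by (simp add: twice_diff_def)
qed

lemma twice_diff_zero: "twice_diff (\<lambda>x::real^'n. 0)"
proof -
  have "grad (\<lambda>x::real^'n. 0) = (\<lambda>x. 0)"
    by (intro ext grad_eqI GDERIV_const)
  then show ?thesis
    by (simp add: twice_diff_def)
qed

lemma twice_diff_sum:
  assumes "finite A" "\<And>i. i \<in> A \<Longrightarrow> twice_diff (\<phi> i)"
  shows "twice_diff (\<lambda>x. \<Sum>i\<in>A. \<phi> i x)"
  using assms by (induction rule: finite_induct) (auto intro: twice_diff_add twice_diff_zero)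

lemma twice_diff_lagrangian:
  assumes "mpsc_smooth P"
  shows "twice_diff (\<lambda>y. lagrangian P y lam \<rho> \<mu> \<nu>)"
  using assms unfolding lagrangian_def mpsc_smooth_def
  by (intro twice_diff_add twice_diff_sum twice_diff_cmult)
     (auto intro: twice_cont_diff_imp_twice_diff)

lemma hessian_has_derivative_grad:
  assumes "twice_diff \<phi>"
  shows "(grad \<phi> has_derivative (\<lambda>h. hessian \<phi> x *v h)) (at x)"
proof -
  have D: "(grad \<phi> has_derivative frechet_derivative (grad \<phi>) (at x)) (at x)"
    using assms by (simp add: twice_diff_def frechet_derivative_works)
  moreover have "hessian \<phi> x *v h = frechet_derivative (grad \<phi>) (at x) h" for h
    unfolding hessian_def using has_derivative_linear[OF D] by (simp add: matrix_works)
  ultimately show ?thesis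
    by simp
qed

text \<open>Were the second derivative negative, \<open>u'\<close> would be negative just to the right of \<open>0\<close>,
  and the mean value theorem would bring \<open>u\<close> below \<open>u 0\<close>.\<close>

lemma second_derivative_nonneg_at_right_min:
  fixes u u' :: "real \<Rightarrow> real"
  assumes "\<delta> > 0"
    and u: "\<And>t. t \<in> {0..<\<delta>} \<Longrightarrow> (u has_real_derivative u' t) (at t within {0..<\<delta>})"
    and "u' 0 = 0"
    and u': "(u' has_real_derivative c) (at 0 within {0..<\<delta>})"
    and min: "eventually (\<lambda>t. u 0 \<le> u t) (at_right 0)"
  shows "c \<ge> 0"
proof (rule ccontr)
  assume "\<not> c \<ge> 0"
  then have "c < 0" by simp
  from has_real_derivative_neg_dec_right[OF u' this] obtain \<eta>
    where \<eta>: "\<eta> > 0" "\<And>h. h > 0 \<Longrightarrow> h \<in> {0..<\<delta>} \<Longrightarrow> h < \<eta> \<Longrightarrow> u' h < 0"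
    using \<open>u' 0 = 0\<close> by auto
  obtain b where b: "b > 0" "\<And>t. 0 < t \<Longrightarrow> t < b \<Longrightarrow> u 0 \<le> u t"
    using min by (auto simp: eventually_at_right_field)
  define s where "s = min (min \<delta> \<eta>) b / 2"
  have s: "0 < s" "s < \<delta>" "s < \<eta>" "s < b"
    using \<open>\<delta> > 0\<close> \<eta>(1) b(1) by (auto simp: s_def)
  have "(u has_derivative (\<lambda>h. u' t * h)) (at t within {0..s})" if "0 \<le> t" "t \<le> s" for t
  proof -
    have "{0..s} \<subseteq> {0..<\<delta>}" "t \<in> {0..<\<delta>}"
      using that s by auto
    then show ?thesis
      using has_field_derivative_subset[OF u, of t "{0..s}"]
      by (simp add: has_field_derivative_def)
  qed
  from mvt_simple[OF s(1) this] obtain t where t: "t \<in> {0<..<s}" "u s - u 0 = u' t * (s - 0)"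
    by blast
  then have "u' t < 0" using \<eta>(2)[of t] s by auto
  then have "u s - u 0 < 0"
    using s(1) by (simp add: t(2) mult_neg_pos)
  moreover have "u 0 \<le> u s" using b(2) s by auto
  ultimately show False by simp
qed

text \<open>The acceleration of the arc enters the second derivative of \<open>\<phi> \<circ> \<zeta>\<close> only through its
  product with the gradient, so at a stationary point the Hessian alone remains.\<close>

lemma hessian_nonneg_along_arc:
  fixes \<phi> :: "real^'n \<Rightarrow> real"
  assumes \<phi>: "twice_diff \<phi>" and stat: "grad \<phi> x = 0"
    and "\<delta> > 0" and arc: "twice_differentiable_arc_on \<zeta> {0..<\<delta>}"
    and x: "\<zeta> 0 = x" and d: "(\<zeta> has_vector_derivative d) (at_right 0)"
    and min: "eventually (\<lambda>t. \<phi> x \<le> \<phi> (\<zeta> t)) (at_right 0)"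
  shows "d \<bullet> (hessian \<phi> x *v d) \<ge> 0"
proof -
  let ?S = "{0..<\<delta>}"
  obtain \<zeta>' where \<zeta>': "\<And>t. t \<in> ?S \<Longrightarrow> (\<zeta> has_vector_derivative \<zeta>' t) (at t within ?S)"
    and diff: "\<zeta>' differentiable_on ?S"
    using arc unfolding twice_differentiable_arc_on_def by blast
  have right: "at 0 within ?S = at_right 0"
    using \<open>\<delta> > 0\<close> by (intro at_within_nhd[of _ "{..<\<delta>}"]) auto
  have "(\<zeta> has_vector_derivative \<zeta>' 0) (at_right 0)"
    using \<zeta>'[of 0] \<open>\<delta> > 0\<close> by (simp add: right)
  then have d_eq: "\<zeta>' 0 = d"
    using d by (rule vector_derivative_unique_within[rotated]) simp
  have "\<zeta>' differentiable (at 0 within ?S)"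
    using diff \<open>\<delta> > 0\<close> by (simp add: differentiable_on_def)
  then obtain \<zeta>'' where \<zeta>'': "(\<zeta>' has_derivative \<zeta>'') (at 0 within ?S)"
    by (auto simp: differentiable_def)
  define u' where "u' t = \<zeta>' t \<bullet> grad \<phi> (\<zeta> t)" for t
  have first: "((\<lambda>t. \<phi> (\<zeta> t)) has_real_derivative u' t) (at t within ?S)" if "t \<in> ?S" for t
  proof -
    have "(\<phi> has_derivative (\<lambda>h. h \<bullet> grad \<phi> (\<zeta> t))) (at (\<zeta> t))"
      using GDERIV_grad[of \<phi>] \<phi> by (simp add: twice_diff_def gderiv_def)
    from has_derivative_compose[OF \<zeta>'[OF that, unfolded has_vector_derivative_def] this]
    show ?thesis
      unfolding has_field_derivative_def u'_def
      by (rule has_derivative_eq_rhs) (simp add: fun_eq_iff)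
  qed
  have "((\<lambda>t. grad \<phi> (\<zeta> t)) has_derivative (\<lambda>h. hessian \<phi> x *v (h *\<^sub>R d))) (at 0 within ?S)"
    using has_derivative_compose[OF \<zeta>'[of 0, unfolded has_vector_derivative_def]
        hessian_has_derivative_grad[OF \<phi>]] \<open>\<delta> > 0\<close>
    by (simp add: x d_eq)
  from has_derivative_inner[OF \<zeta>'' this]
  have second: "(u' has_real_derivative d \<bullet> (hessian \<phi> x *v d)) (at 0 within ?S)"
    unfolding u'_def has_field_derivative_def
    by (rule has_derivative_eq_rhs)
       (simp add: fun_eq_iff x d_eq stat matrix_vector_mult_scaleR)
  show ?thesis
  proof (rule second_derivative_nonneg_at_right_min)
    show "\<delta> > 0" "u' 0 = 0" "(u' has_real_derivative d \<bullet> (hessian \<phi> x *v d)) (at 0 within ?S)"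
      using \<open>\<delta> > 0\<close> second by (simp_all add: u'_def[of 0] x stat)
    show "((\<lambda>t. \<phi> (\<zeta> t)) has_real_derivative u' t) (at t within ?S)" if "t \<in> ?S" for t
      using that by (fact first)
    show "eventually (\<lambda>t. \<phi> (\<zeta> 0) \<le> \<phi> (\<zeta> t)) (at_right 0)"
      using min by (simp add: x)
  qed
qed

text \<open>Complementary slackness holds termwise, since the terms of
  \<open>\<lambda>\<^sup>T g(x)\<close> are all nonpositive.\<close>

lemma inactive_multiplier_zero:
  assumes "x \<in> feasible_set P" "S_stationarity_system P x lam \<rho> \<mu> \<nu>"
    and "i \<in> {1..num_ineq P}" "i \<notin> I_g P x"
  shows "lam i = 0"
proof -
  have nonneg: "0 \<le> - (lam j * ineq_con P j x)" if "j \<in> {1..num_ineq P}" for j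
    using assms(1,2) that
    by (simp add: feasible_set_def S_stationarity_system_def mult_nonneg_nonpos)
  have "(\<Sum>j=1..num_ineq P. - (lam j * ineq_con P j x)) = 0"
    using assms(2) by (simp add: S_stationarity_system_def sum_negf)
  then have "lam i * ineq_con P i x = 0"
    using nonneg assms(3) by (subst (asm) sum_nonneg_eq_0_iff) auto
  then show ?thesis
    using assms(3,4) by (auto simp: I_g_def)
qed

lemma lagrangian_eq_objective:
  assumes x: "x \<in> feasible_set P" and S: "S_stationarity_system P x lam \<rho> \<mu> \<nu>"
    and y: "y \<in> feasible_set P"
    and g: "\<And>i. i \<in> I_g P x \<Longrightarrow> ineq_con P i y = 0"
    and G: "\<And>k. k \<in> I_G P x \<Longrightarrow> switchG P k y = 0"
    and H: "\<And>k. k \<in> I_H P x \<Longrightarrow> switchH P k y = 0"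
  shows "lagrangian P y lam \<rho> \<mu> \<nu> = objective P y"
proof -
  have "lam i * ineq_con P i y = 0" if "i \<in> {1..num_ineq P}" for i
    using inactive_multiplier_zero[OF x S that] g by auto
  moreover have "\<rho> j * eq_con P j y = 0" if "j \<in> {1..num_eq P}" for j
    using y that by (simp add: feasible_set_def)
  moreover have "\<mu> k * switchG P k y = 0" "\<nu> k * switchH P k y = 0"
    if k: "k \<in> {1..num_switch P}" for k
  proof -
    have "k \<in> I_G P x \<or> k \<in> I_H P x \<or> k \<in> I_GH P x"
      using x k by (auto simp: feasible_set_def I_G_def I_H_def I_GH_def)
    then show "\<mu> k * switchG P k y = 0" "\<nu> k * switchH P k y = 0"
      using S G H by (auto simp: S_stationarity_system_def)
  qed
  ultimately show ?thesis
    by (simp add: lagrangian_def sum.neutral del: mult_eq_0_iff)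
qed

theorem theorem5p2:
  fixes P :: "'n::finite mpsc" and xbar :: "real^'n"
  assumes "mpsc_smooth P"
    and "xbar \<in> feasible_set P"
    and "locally_optimal P xbar"
    and "S_stationary P xbar"
    and "MPSC_WSOCQ P xbar"
  shows "MPSC_WSONC P xbar"
  unfolding MPSC_WSONC_def
proof (intro allI impI ballI)
  fix lam \<rho> \<mu> \<nu> d
  assume S: "S_stationarity_system P xbar lam \<rho> \<mu> \<nu>" and crit: "d \<in> critical_subspace P xbar"
  let ?L = "\<lambda>y. lagrangian P y lam \<rho> \<mu> \<nu>"
  show "0 \<le> d \<bullet> (hessian ?L xbar *v d)"
  proof (cases "d = 0")
    case False
    with assms(5) crit obtain \<delta> J K \<zeta> where \<delta>: "\<delta> > 0"
      and arc: "twice_differentiable_arc_on \<zeta> {0..<\<delta>}"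
      and feas: "\<forall>t\<in>{0..<\<delta>}. \<zeta> t \<in> feasible_set P"
      and x: "\<zeta> 0 = xbar" and d: "(\<zeta> has_vector_derivative d) (at_right 0)"
      and active: "\<forall>t\<in>{0..<\<delta>}.
              (\<forall>i\<in>I_g P xbar. ineq_con P i (\<zeta> t) = 0) \<and>
              (\<forall>k\<in>I_G P xbar \<union> J. switchG P k (\<zeta> t) = 0) \<and>
              (\<forall>k\<in>I_H P xbar \<union> K. switchH P k (\<zeta> t) = 0)"
      unfolding MPSC_WSOCQ_def by blast
    have L: "?L (\<zeta> t) = objective P (\<zeta> t)" if "t \<in> {0..<\<delta>}" for t
      using that feas active by (intro lagrangian_eq_objective[OF assms(2) S]) auto
    obtain \<epsilon> where "\<epsilon> > 0"
      and opt: "\<And>y. y \<in> feasible_set P \<Longrightarrow> y \<in> ball xbar \<epsilon> \<Longrightarrow> objective P xbar \<le> objective P y"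
      using assms(3) by (auto simp: locally_optimal_def)
    have "(\<zeta> \<longlongrightarrow> xbar) (at_right 0)"
      using has_derivative_continuous[OF d[unfolded has_vector_derivative_def]] x
      by (simp add: continuous_within)
    then have near: "eventually (\<lambda>t. dist (\<zeta> t) xbar < \<epsilon>) (at_right 0)"
      using \<open>\<epsilon> > 0\<close> by (rule tendstoD)
    have short: "eventually (\<lambda>t. t \<in> {0<..<\<delta>}) (at_right 0)"
      using \<delta> by (rule eventually_at_right_real)
    have "eventually (\<lambda>t. ?L xbar \<le> ?L (\<zeta> t)) (at_right 0)"
      using near short
    proof eventually_elim
      case (elim t)
      then have "objective P xbar \<le> objective P (\<zeta> t)"
        using feas by (intro opt) (auto simp: dist_commute)
      then show ?case
        using L[of t] L[of 0] elim \<delta> x by simp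
    qed
    moreover have "grad ?L xbar = 0"
      using S by (simp add: S_stationarity_system_def)
    ultimately show ?thesis
      using hessian_nonneg_along_arc[OF twice_diff_lagrangian[OF assms(1)] _ \<delta> arc x d] by blast
  qed simp
qed

end
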